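(* Let $D_{11}$ be the Jordan quadruple system over $\mathbb{Q}$ of all $3\times3$ matrices $\begin{bmatrix} 0 & 0 & x \\ x & 0 & 0 \\ 0 & y & 0 \end{bmatrix}$ ($x,y\in\mathbb{Q}$) under the tetrad $\{a,b,c,d\}=abcd+dcba$. Then its universal associative envelope satisfies $U(D_{11})\cong\mathbb{Q}\oplus M_3(\mathbb{Q})$ as associative algebras, and hence, up to isomorphism, $D_{11}$ has only two finite dimensional irreducible representations: the 1-dimensional trivial representation and the 3-dimensional natural representation.
   Context: Let $J$ be a subspace of a matrix algebra over $\mathbb{Q}$ closed under the tetrad, with basis $B$. Its universal associative envelope is $U(J)=\mathbb{Q}\langle B\rangle/I(G)$, where $\mathbb{Q}\langle B\rangle$ is the free unital associative algebra on $B$ and $I(G)$ is the two-sided ideal generated by the elements $abcd+dcba-\{a,b,c,d\}$ for $a,b,c,d\in B$, with $\{a,b,c,d\}\in J$ computed in $J$ and written as a linear combination of $B$. A representation of $J$ on a vector space $V$ is a linear map $\rho\colon J\to\mathrm{End}(V)$ with $\rho(\{a,b,c,d\})=\rho(a)\rho(b)\rho(c)\rho(d)+\rho(d)\rho(c)\rho(b)\rho(a)$; equivalently, a unital left $U(J)$-module. The trivial representation is $\rho=0$ on a 1-dimensional space; the natural representation is the inclusion of $J$ in the matrix algebra acting on column vectors. *)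

theory Defs
  imports "HOL-Analysis.Analysis" "HOL-Algebra.Chinese_Remainder" "HOL-Algebra.Module"
    "HOL-Library.Poly_Mapping"
begin

definition mat_scale :: "rat \<Rightarrow> rat^'n^'n \<Rightarrow> rat^'n^'n"
  where "mat_scale c A = (\<chi> i j. c * A $ i $ j)"

interpretation mat_vs: vector_space mat_scale
  by unfold_locales (simp_all add: mat_scale_def vec_eq_iff algebra_simps)

definition tetrad :: "rat^'n^'n \<Rightarrow> rat^'n^'n \<Rightarrow> rat^'n^'n \<Rightarrow> rat^'n^'n \<Rightarrow> rat^'n^'n"
  where "tetrad a b c d = a ** b ** c ** d + d ** c ** b ** a"

definition jordan_quadruple_system :: "(rat^'n^'n) set \<Rightarrow> bool"
  where "jordan_quadruple_system J \<longleftrightarrow>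
    mat_vs.subspace J \<and> (\<forall>a\<in>J. \<forall>b\<in>J. \<forall>c\<in>J. \<forall>d\<in>J. tetrad a b c d \<in> J)"

definition D11 :: "(rat^3^3) set"
  where "D11 = {vector [vector [0, 0, x],
                        vector [x, 0, 0],
                        vector [0, y, 0]] | x y. True}"

lemma jordan_quadruple_system_D11: "jordan_quadruple_system D11"
proof -
  define m :: "rat \<Rightarrow> rat \<Rightarrow> rat^3^3"
    where "m x y = vector [vector [0, 0, x], vector [x, 0, 0], vector [0, y, 0]]" for x y
  have D: "D11 = {m x y | x y. True}" by (simp add: D11_def m_def)
  have z: "0 = m 0 0"
    by (simp add: m_def vec_eq_iff forall_3)
  have s: "m x y + m x' y' = m (x + x') (y + y')" for x y x' y'
    by (simp add: m_def vec_eq_iff forall_3)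
  have c: "mat_scale k (m x y) = m (k * x) (k * y)" for k x y
    by (simp add: m_def vec_eq_iff forall_3 mat_scale_def)
  have t: "tetrad (m x1 y1) (m x2 y2) (m x3 y3) (m x4 y4)
      = m (x1 * x4 * (x2 * y3 + y2 * x3)) (2 * y1 * y4 * x2 * x3)" for x1 y1 x2 y2 x3 y3 x4 y4
    by (simp add: tetrad_def m_def vec_eq_iff forall_3 matrix_matrix_mult_def sum_3 algebra_simps)
  show ?thesis
    unfolding jordan_quadruple_system_def mat_vs.subspace_def D
    using z s c t by (safe; blast)
qed

text \<open>
  A unital associative algebra is given by the record type of HOL-Algebra modules, which has a
  multiplication, a unit and a scalar action. The locale \<open>algebra\<close> of HOL-Algebra
  is not used because it requires a commutative multiplication.
\<close>

definition alg_isomorphic :: "(rat, 'a) module \<Rightarrow> (rat, 'b) module \<Rightarrow> bool"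
  where "alg_isomorphic A B \<longleftrightarrow>
    (\<exists>h \<in> ring_iso A B. \<forall>c. \<forall>x\<in>carrier A. h (c \<odot>\<^bsub>A\<^esub> x) = c \<odot>\<^bsub>B\<^esub> h x)"

definition rat_alg :: "(rat, rat) module"
  where "rat_alg = \<lparr>carrier = UNIV, mult = (*), one = 1, zero = 0, add = (+), smult = (*)\<rparr>"

definition mat_alg :: "(rat, rat^'n^'n) module"
  where "mat_alg = \<lparr>carrier = UNIV, mult = (**), one = mat 1, zero = 0, add = (+),
                    smult = mat_scale\<rparr>"

definition alg_direct_sum :: "(rat, 'a) module \<Rightarrow> (rat, 'b) module \<Rightarrow> (rat, 'a \<times> 'b) module"
  where "alg_direct_sum A B = ring.extend (RDirProd A B)
    (module.fields (\<lambda>c (x, y). (c \<odot>\<^bsub>A\<^esub> x, c \<odot>\<^bsub>B\<^esub> y)))"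

text \<open>
  The scalar multiple of a coset \<open>X = I + x\<close> is \<open>I + c x\<close>; adding \<open>I\<close>
  is needed only for \<open>c = 0\<close>.
\<close>

definition alg_quotient :: "(rat, 'a) module \<Rightarrow> 'a set \<Rightarrow> (rat, 'a set) module"
  where "alg_quotient A I = ring.extend (A Quot I)
    (module.fields (\<lambda>c X. I <+>\<^bsub>A\<^esub> ((\<lambda>x. c \<odot>\<^bsub>A\<^esub> x) ` X)))"

text \<open>
  Lists under concatenation form the free monoid, so the convolution product of
  \<^theory>\<open>HOL-Library.Poly_Mapping\<close> on finitely supported functions from lists to the rationals is
  the multiplication of noncommutative polynomials. The free algebra on a set \<open>B\<close> consists of the
  polynomials all of whose words have letters in \<open>B\<close>.
\<close>

instantiation list :: (type) monoid_add
begin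

definition zero_list :: "'a list" where "zero_list = []"

definition plus_list :: "'a list \<Rightarrow> 'a list \<Rightarrow> 'a list" where "plus_list = (@)"

instance
  by intro_classes (simp_all add: zero_list_def plus_list_def)

end

definition free_alg :: "'b set \<Rightarrow> (rat, 'b list \<Rightarrow>\<^sub>0 rat) module"
  where "free_alg B =
    \<lparr>carrier = {f. \<forall>w \<in> Poly_Mapping.keys f. set w \<subseteq> B},
     mult = (*), one = 1, zero = 0, add = (+),
     smult = (\<lambda>c. Poly_Mapping.map ((*) c))\<rparr>"

lemma ring_free_alg: "ring (free_alg B)"
proof (rule ringI)
  have sub: "Poly_Mapping.keys (- f) = Poly_Mapping.keys f" for f :: "'a list \<Rightarrow>\<^sub>0 rat"
    by (simp add: keys_def)
  show "abelian_group (free_alg B)"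
  proof (rule abelian_groupI)
    fix f assume "f \<in> carrier (free_alg B)"
    then show "\<exists>g\<in>carrier (free_alg B). g \<oplus>\<^bsub>free_alg B\<^esub> f = \<zero>\<^bsub>free_alg B\<^esub>"
      by (intro bexI[of _ "- f"]) (auto simp: free_alg_def sub)
  next
    fix f g assume "f \<in> carrier (free_alg B)" "g \<in> carrier (free_alg B)"
    then show "f \<oplus>\<^bsub>free_alg B\<^esub> g \<in> carrier (free_alg B)"
      using Poly_Mapping.keys_add[of f g] by (auto simp: free_alg_def)
  qed (auto simp: free_alg_def algebra_simps)
  show "Group.monoid (free_alg B)"
  proof (rule monoidI)
    fix f g assume "f \<in> carrier (free_alg B)" "g \<in> carrier (free_alg B)"
    then show "f \<otimes>\<^bsub>free_alg B\<^esub> g \<in> carrier (free_alg B)"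
      using keys_mult[of f g] by (fastforce simp: free_alg_def plus_list_def)
  qed (auto simp: free_alg_def zero_list_def mult.assoc)
qed (auto simp: free_alg_def algebra_simps)

definition monomial :: "'b list \<Rightarrow> ('b list \<Rightarrow>\<^sub>0 rat)"
  where "monomial w = Poly_Mapping.single w 1"

text \<open>
  An element of the span of a basis \<open>B\<close>, written as a linear combination of \<open>B\<close> and read as
  a noncommutative polynomial of degree one.
\<close>

definition linear_form ::
  "(rat^'n^'n) set \<Rightarrow> rat^'n^'n \<Rightarrow> ((rat^'n^'n) list \<Rightarrow>\<^sub>0 rat)"
  where "linear_form B v =
    (\<Sum>e | mat_vs.representation B v e \<noteq> 0.
       Poly_Mapping.single [e] (mat_vs.representation B v e))"

definition envelope_relations :: "(rat^'n^'n) set \<Rightarrow> ((rat^'n^'n) list \<Rightarrow>\<^sub>0 rat) set"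
  where "envelope_relations B =
    {monomial [a, b, c, d] + monomial [d, c, b, a] - linear_form B (tetrad a b c d)
      | a b c d. a \<in> B \<and> b \<in> B \<and> c \<in> B \<and> d \<in> B}"

definition universal_envelope ::
  "(rat^'n^'n) set \<Rightarrow> (rat, ((rat^'n^'n) list \<Rightarrow>\<^sub>0 rat) set) module"
  where "universal_envelope B =
    alg_quotient (free_alg B) (Idl\<^bsub>free_alg B\<^esub> (envelope_relations B))"

definition mat_basis :: "(rat^'n^'n) set \<Rightarrow> (rat^'n^'n) set \<Rightarrow> bool"
  where "mat_basis J B \<longleftrightarrow> mat_vs.independent B \<and> mat_vs.span B = J"

text \<open>
  A vector space is a type with a scalar multiplication \<open>smul\<close> satisfying \<^locale>\<open>vector_space\<close>.
  The values of \<open>\<rho>\<close> outside \<open>J\<close> are irrelevant.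
\<close>

definition quad_representation ::
  "(rat^'n^'n) set \<Rightarrow> (rat \<Rightarrow> 'v \<Rightarrow> 'v::ab_group_add) \<Rightarrow> (rat^'n^'n \<Rightarrow> 'v \<Rightarrow> 'v) \<Rightarrow> bool"
  where "quad_representation J smul \<rho> \<longleftrightarrow>
    vector_space smul \<and>
    (\<forall>a\<in>J. Vector_Spaces.linear smul smul (\<rho> a)) \<and>
    (\<forall>a\<in>J. \<forall>b\<in>J. \<forall>v. \<rho> (a + b) v = \<rho> a v + \<rho> b v) \<and>
    (\<forall>k. \<forall>a\<in>J. \<forall>v. \<rho> (mat_scale k a) v = smul k (\<rho> a v)) \<and>
    (\<forall>a\<in>J. \<forall>b\<in>J. \<forall>c\<in>J. \<forall>d\<in>J. \<forall>v.
       \<rho> (tetrad a b c d) v = \<rho> a (\<rho> b (\<rho> c (\<rho> d v))) + \<rho> d (\<rho> c (\<rho> b (\<rho> a v))))"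

definition finite_dim :: "(rat \<Rightarrow> 'v \<Rightarrow> 'v::ab_group_add) \<Rightarrow> bool"
  where "finite_dim smul \<longleftrightarrow> (\<exists>Basis. finite_dimensional_vector_space smul Basis)"

definition irreducible_representation ::
  "(rat^'n^'n) set \<Rightarrow> (rat \<Rightarrow> 'v \<Rightarrow> 'v::ab_group_add) \<Rightarrow> (rat^'n^'n \<Rightarrow> 'v \<Rightarrow> 'v) \<Rightarrow> bool"
  where "irreducible_representation J smul \<rho> \<longleftrightarrow>
    quad_representation J smul \<rho> \<and>
    (\<exists>v::'v. v \<noteq> 0) \<and>
    (\<forall>W. module.subspace smul W \<and> (\<forall>a\<in>J. \<forall>w\<in>W. \<rho> a w \<in> W) \<longrightarrow> W = {0} \<or> W = UNIV)"

definition isomorphic_representations ::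
  "(rat^'n^'n) set \<Rightarrow> (rat \<Rightarrow> 'v \<Rightarrow> 'v::ab_group_add) \<Rightarrow> (rat^'n^'n \<Rightarrow> 'v \<Rightarrow> 'v) \<Rightarrow>
   (rat \<Rightarrow> 'w \<Rightarrow> 'w::ab_group_add) \<Rightarrow> (rat^'n^'n \<Rightarrow> 'w \<Rightarrow> 'w) \<Rightarrow> bool"
  where "isomorphic_representations J smul1 \<rho> smul2 \<sigma> \<longleftrightarrow>
    (\<exists>f. Vector_Spaces.linear smul1 smul2 f \<and> bij f \<and>
         (\<forall>a\<in>J. \<forall>v. f (\<rho> a v) = \<sigma> a (f v)))"

definition trivial_rep :: "rat^'n^'n \<Rightarrow> rat \<Rightarrow> rat"
  where "trivial_rep a v = 0"

definition natural_rep :: "rat^'n^'n \<Rightarrow> rat^'n \<Rightarrow> rat^'n"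
  where "natural_rep a v = a *v v"

end

theory Submission
  imports Defs
begin

text \<open>
  Put \<open>a\<close> for the matrix with \<open>(x, y) = (1, 0)\<close> and \<open>b\<close> for the one with \<open>(0, 1)\<close>. The tetrad
  relations include \<open>a\<^sup>4 = b\<^sup>4 = 0\<close>, \<open>aabb + bbaa = 0\<close>, \<open>aaab + baaa = 0\<close>,
  \<open>aaba + abaa = a\<close> and \<open>baab = b\<close>, and these imply \<open>aaa = bb = bab = 0\<close>. Hence every
  \<open>u = bv\<close> satisfies \<open>baau = u\<close>, \<open>bu = bau = aaau = 0\<close>: the vectors \<open>au\<close>, \<open>aau\<close>, \<open>u\<close> are permuted
  like the standard basis of the natural representation. In the envelope, taking \<open>u\<close> to be \<open>ba\<close>,
  \<open>b\<close>, \<open>baa\<close> gives the three columns of a system of matrix units, which spans the envelope together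
  with \<open>1\<close>; evaluation at \<open>0\<close> and in the matrices shows that these ten elements are independent.
  In an irreducible representation the common kernel of \<open>a\<close> and \<open>b\<close> is everything (trivial case)
  or zero, and then some \<open>u = baav\<close> is nonzero and generates a copy of the natural representation.
\<close>

section \<open>Coordinates on \<open>D11\<close> and its tetrad\<close>

definition d11_mat :: "rat \<Rightarrow> rat \<Rightarrow> rat^3^3"
  where "d11_mat x y = vector [vector [0, 0, x], vector [x, 0, 0], vector [0, y, 0]]"

lemma D11_eq: "D11 = {d11_mat x y | x y. True}"
  by (simp add: D11_def d11_mat_def)

lemma d11_mat_in_D11 [simp]: "d11_mat x y \<in> D11"
  by (auto simp: D11_eq)

lemma d11_mat_0 [simp]: "d11_mat 0 0 = 0"
  by (simp add: d11_mat_def vec_eq_iff forall_3)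

lemma d11_mat_decompose:
  "d11_mat x y = mat_scale x (d11_mat 1 0) + mat_scale y (d11_mat 0 1)"
  by (simp add: d11_mat_def vec_eq_iff forall_3 mat_scale_def)

text \<open>Every relation between the two generators is read off from this formula by setting each
  coordinate pair to \<open>(1, 0)\<close> or \<open>(0, 1)\<close>.\<close>

lemma tetrad_d11_mat:
  "tetrad (d11_mat x1 y1) (d11_mat x2 y2) (d11_mat x3 y3) (d11_mat x4 y4)
    = d11_mat (x1 * x4 * (x2 * y3 + y2 * x3)) (2 * y1 * y4 * x2 * x3)"
  by (simp add: tetrad_def d11_mat_def vec_eq_iff forall_3 matrix_matrix_mult_def sum_3 algebra_simps)

lemma d11_mat_mult_vector:
  "d11_mat p q *v x = vector [p * x $ 3, p * x $ 1, q * x $ 2]"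
  by (simp add: d11_mat_def vec_eq_iff forall_3 matrix_vector_mult_def sum_3)

lemma subspace_D11: "mat_vs.subspace D11"
  using jordan_quadruple_system_D11 by (simp add: jordan_quadruple_system_def)

lemma tetrad_in_D11: "a \<in> D11 \<Longrightarrow> b \<in> D11 \<Longrightarrow> c \<in> D11 \<Longrightarrow> d \<in> D11 \<Longrightarrow> tetrad a b c d \<in> D11"
  using jordan_quadruple_system_D11 by (simp add: jordan_quadruple_system_def)

text \<open>
  Operators modulo a subgroup \<open>N\<close>, acting on \<open>C\<close>: representations are the case \<open>N = {0}\<close>,
  and the envelope acting on itself by left multiplication is the case where \<open>N\<close> is the ideal of
  relations.
\<close>

locale d11_action =
  fixes C N :: "'v::ab_group_add set" and a b :: "'v \<Rightarrow> 'v"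
  assumes N_0: "0 \<in> N"
    and N_diff: "x \<in> N \<Longrightarrow> y \<in> N \<Longrightarrow> x - y \<in> N"
    and a_diff: "a (x - y) = a x - a y"
    and b_diff: "b (x - y) = b x - b y"
    and a_N: "x \<in> N \<Longrightarrow> a x \<in> N"
    and b_N: "x \<in> N \<Longrightarrow> b x \<in> N"
    and a_C: "v \<in> C \<Longrightarrow> a v \<in> C"
    and b_C: "v \<in> C \<Longrightarrow> b v \<in> C"
    and aaaa: "v \<in> C \<Longrightarrow> a (a (a (a v))) \<in> N"
    and bbbb: "v \<in> C \<Longrightarrow> b (b (b (b v))) \<in> N"
    and aabb: "v \<in> C \<Longrightarrow> a (a (b (b v))) + b (b (a (a v))) \<in> N"
    and aaab: "v \<in> C \<Longrightarrow> a (a (a (b v))) + b (a (a (a v))) \<in> N"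
    and aaba: "v \<in> C \<Longrightarrow> a (a (b (a v))) + a (b (a (a v))) - a v \<in> N"
    and baab: "v \<in> C \<Longrightarrow> b (a (a (b v))) - b v \<in> N"
begin

section \<open>Short words that vanish modulo \<open>N\<close>\<close>

lemma N_uminus: "x \<in> N \<Longrightarrow> - x \<in> N"
  using N_diff[OF N_0] by simp

lemma N_add: "x \<in> N \<Longrightarrow> y \<in> N \<Longrightarrow> x + y \<in> N"
  using N_diff[OF _ N_uminus] by simp

lemma a_0: "a 0 = 0" and b_0: "b 0 = 0"
  using a_diff[of 0 0] b_diff[of 0 0] by simp_all

lemma a_add: "a (x + y) = a x + a y" and b_add: "b (x + y) = b x + b y"
  using a_diff[of x "- y"] a_diff[of 0 y] b_diff[of x "- y"] b_diff[of 0 y]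
  by (simp_all add: a_0 b_0)

lemmas ab_simps = a_diff b_diff a_add b_add

text \<open>Multiplying \<open>aabb + bbaa\<close> on the left by \<open>b\<close> and reducing
  \<open>baab\<close> to \<open>b\<close> leaves \<open>bb + bbbaa\<close>. One more
  \<open>b\<close> produces a \<open>bbbb\<close> term, so \<open>bbb\<close> vanishes modulo
  \<open>N\<close>, and with it the term \<open>bbbaa\<close>.\<close>

lemma bb:
  assumes v: "v \<in> C"
  shows "b (b v) \<in> N"
proof -
  have *: "b (b v) + b (b (b (a (a v)))) \<in> N" if "v \<in> C" for v
    using N_diff[OF b_N[OF aabb[of v]] baab[of "b v"]] that by (simp add: ab_simps b_C algebra_simps)
  have "b (b (b v)) \<in> N" if "v \<in> C" for v
    using N_diff[OF b_N[OF *[of v]] bbbb[of "a (a v)"]] that by (simp add: ab_simps a_C)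
  then show ?thesis
    using N_diff[OF *, of v "b (b (b (a (a v))))"] v by (simp add: a_C)
qed

text \<open>Multiplying \<open>aaba + abaa - a\<close> on the left by \<open>aa\<close> gives
  \<open>aaaaba + aaabaa - aaa\<close>. The first word starts with \<open>aaaa\<close>; the second
  is handled by \<open>aaab\<close> applied to \<open>aav\<close>, whose other term contains
  \<open>aaaa\<close>.\<close>

lemma aaa:
  assumes v: "v \<in> C"
  shows "a (a (a v)) \<in> N"
proof -
  have "a (a (a (b (a (a v))))) \<in> N"
    using N_diff[OF aaab[of "a (a v)"] b_N[OF a_N[OF aaaa[of v]]]] v by (simp add: a_C)
  with aaaa[of "b (a v)"] have "a (a (a (a (b (a v))))) + a (a (a (b (a (a v))))) \<in> N"
    using v by (simp add: N_add a_C b_C)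
  from N_diff[OF this a_N[OF a_N[OF aaba[of v]]]] v show ?thesis
    by (simp add: ab_simps)
qed

text \<open>The relation \<open>aaba\<close> at \<open>bv\<close>, multiplied by \<open>b\<close>,
  compares \<open>baabab + babaab\<close> with \<open>bab\<close>. By \<open>baab\<close>, used on
  the first or the last four letters, both words on the left reduce to \<open>bab\<close>, so
  \<open>bab + bab\<close> and \<open>bab\<close> agree modulo \<open>N\<close>.\<close>

lemma bab:
  assumes v: "v \<in> C"
  shows "b (a (b v)) \<in> N"
  using N_diff[OF b_N[OF aaba[of "b v"]]
      N_add[OF baab[of "a (b v)"] b_N[OF a_N[OF baab[of v]]]]] v
  by (simp add: ab_simps a_C b_C algebra_simps)

end

section \<open>Representations\<close>

lemma irreducible_trivial_rep:
  "irreducible_representation D11 ((*) :: rat \<Rightarrow> rat \<Rightarrow> rat) trivial_rep"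
proof -
  have "W = UNIV" if W: "vector_space_over_itself.subspace W" and x: "x \<in> W" "x \<noteq> 0" for W and x :: rat
  proof -
    have "y \<in> W" for y
      using vector_space_over_itself.subspace_scale[OF W x(1), of "y / x"] x(2) by simp
    then show ?thesis by blast
  qed
  then have "W = {0} \<or> W = UNIV" if "vector_space_over_itself.subspace W" for W :: "rat set"
    using that vector_space_over_itself.subspace_0[OF that] by fast
  then show ?thesis
    unfolding irreducible_representation_def quad_representation_def
    by (auto simp: trivial_rep_def Vector_Spaces.linear_iff
        vector_space_over_itself.vector_space_axioms intro: exI[of _ 1])
qed

lemma irreducible_natural_rep:
  "irreducible_representation D11 ((*s) :: rat \<Rightarrow> rat^3 \<Rightarrow> rat^3) natural_rep"
proof -
  have "W = UNIV"
    if W: "vec.subspace W" and inv: "\<forall>a\<in>D11. \<forall>w\<in>W. natural_rep a w \<in> W" and "w \<in> W" "w \<noteq> 0"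
    for W and w :: "rat^3"
  proof -
    have a: "vector [x $ 3, x $ 1, 0] \<in> W" and b: "vector [0, 0, x $ 2] \<in> W"
      if "x \<in> W" for x
      using inv[rule_format, OF _ that, of "d11_mat 1 0"] inv[rule_format, OF _ that, of "d11_mat 0 1"]
      by (simp_all add: natural_rep_def d11_mat_mult_vector)
    have scale: "c *s x \<in> W" if "x \<in> W" for c x
      using vec.subspace_scale[OF W that] .
    \<comment> \<open>Applying \<open>b\<close> after zero, one or two applications of
      \<open>a\<close> isolates each coordinate in the third place. A nonzero one yields the third
      standard vector, and \<open>a\<close> carries that to the first and then to the
      second.\<close>
    have "vector [0, 0, w $ 1] \<in> W" "vector [0, 0, w $ 2] \<in> W" "vector [0, 0, w $ 3] \<in> W"
      using b[OF a[OF \<open>w \<in> W\<close>]] b[OF \<open>w \<in> W\<close>] b[OF a[OF a[OF \<open>w \<in> W\<close>]]] by simp_all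
    moreover obtain i where i: "w $ i \<noteq> 0"
      using \<open>w \<noteq> 0\<close> by (auto simp: vec_eq_iff)
    ultimately have "vector [0, 0, w $ i] \<in> W"
      using exhaust_3[of i] by auto
    from scale[OF this, of "1 / (w $ i)"]
    have "(1 / (w $ i)) *s vector [0, 0, w $ i] \<in> W" .
    moreover have "(1 / (w $ i)) *s vector [0, 0, w $ i] = (vector [0, 0, 1] :: rat^3)"
      using i by (simp add: vec_eq_iff forall_3)
    ultimately have e3: "vector [0, 0, 1] \<in> W"
      by simp
    have e1: "vector [1, 0, 0] \<in> W"
      using a[OF e3] by simp
    have e2: "vector [0, 1, 0] \<in> W"
      using a[OF e1] by simp
    have "y \<in> W" for y
    proof -
      have "y = y $ 1 *s vector [1, 0, 0] + y $ 2 *s vector [0, 1, 0] + y $ 3 *s vector [0, 0, 1]"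
        by (simp add: vec_eq_iff forall_3)
      then show ?thesis
        using scale e1 e2 e3 vec.subspace_add[OF W] by metis
    qed
    then show ?thesis by blast
  qed
  then have "W = {0} \<or> W = UNIV"
    if "vec.subspace W" "\<forall>a\<in>D11. \<forall>w\<in>W. natural_rep a w \<in> W" for W :: "(rat^3) set"
    using that vec.subspace_0[OF that(1)] by blast
  moreover have "vector [1, 0, 0] \<noteq> (0 :: rat^3)"
    by (simp add: vec_eq_iff forall_3)
  moreover have "quad_representation D11 ((*s) :: rat \<Rightarrow> rat^3 \<Rightarrow> rat^3) natural_rep"
    unfolding quad_representation_def natural_rep_def
    by (simp add: Vector_Spaces.linear_iff vec.vector_space_axioms matrix_vector_right_distrib
        matrix_vector_mult_add_rdistrib tetrad_def matrix_vector_mul_assoc matrix_mul_assoc)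
      (simp add: mat_scale_def matrix_vector_mult_def vec_eq_iff sum_distrib_left mult_ac)
  ultimately show ?thesis
    unfolding irreducible_representation_def by blast
qed

text \<open>The classification builds intertwiners from the known representations into the unknown
  one, whereas the conclusion asks for the opposite direction.\<close>

lemma isomorphic_representations_flip:
  assumes lin: "Vector_Spaces.linear smul1 smul2 f" and f: "bij f"
    and inv: "\<And>a v. a \<in> J \<Longrightarrow> f (\<rho> a v) = \<sigma> a (f v)"
  shows "isomorphic_representations J smul2 \<sigma> smul1 \<rho>"
  unfolding isomorphic_representations_def
proof (intro exI conjI ballI allI)
  have *: "Hilbert_Choice.inv f x = y \<longleftrightarrow> x = f y" for x y
    using f by (auto simp: bij_def surj_f_inv_f)
  have ff: "f (Hilbert_Choice.inv f x) = x" for x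
    using f by (simp add: bij_def surj_f_inv_f)
  show "Vector_Spaces.linear smul2 smul1 (Hilbert_Choice.inv f)"
    using lin by (auto simp: Vector_Spaces.linear_iff * ff)
  show "bij (Hilbert_Choice.inv f)"
    using f by (rule bij_imp_bij_inv)
  show "Hilbert_Choice.inv f (\<sigma> a v) = \<rho> a (Hilbert_Choice.inv f v)" if "a \<in> J" for a v
    using that by (simp add: * inv ff)
qed

text \<open>An intertwiner \<open>f\<close> would satisfy
  \<open>f 0 = natural_rep (d11_mat 1 0) (f v)\<close> for every \<open>v\<close>. Surjectivity lets
  \<open>f v\<close> be zero or the first standard vector, and the results differ in the second
  coordinate.\<close>

lemma not_isomorphic_trivial_natural:
  "\<not> isomorphic_representations D11 ((*) :: rat \<Rightarrow> rat \<Rightarrow> rat) trivial_rep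
      ((*s) :: rat \<Rightarrow> rat^3 \<Rightarrow> rat^3) natural_rep"
proof
  assume "isomorphic_representations D11 ((*) :: rat \<Rightarrow> rat \<Rightarrow> rat) trivial_rep
      ((*s) :: rat \<Rightarrow> rat^3 \<Rightarrow> rat^3) natural_rep"
  then obtain f :: "rat \<Rightarrow> rat^3" where f: "bij f" "f 0 = natural_rep (d11_mat 1 0) (f v)" for v
    unfolding isomorphic_representations_def trivial_rep_def by (metis d11_mat_in_D11)
  obtain v w where vw: "f v = 0" "f w = vector [1, 0, 0]"
    using f(1) by (metis bij_pointE)
  have "f 0 $ 2 = 1"
    by (simp add: f(2)[of w] vw natural_rep_def d11_mat_mult_vector)
  moreover have "f 0 $ 2 = 0"
    by (subst f(2)[of v]) (simp add: vw natural_rep_def d11_mat_mult_vector)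
  ultimately show False
    by simp
qed

section \<open>Classification of the irreducible representations\<close>

context
  fixes smul :: "rat \<Rightarrow> 'v \<Rightarrow> 'v::ab_group_add" and \<rho> :: "rat^3^3 \<Rightarrow> 'v \<Rightarrow> 'v"
  assumes rep: "quad_representation D11 smul \<rho>"
begin

interpretation vector_space smul
  using rep by (simp add: quad_representation_def)

lemma rep_linear:
  assumes "m \<in> D11"
  shows "\<rho> m (x + y) = \<rho> m x + \<rho> m y" "\<rho> m (smul c x) = smul c (\<rho> m x)" "\<rho> m 0 = 0"
    "\<rho> m (x - y) = \<rho> m x - \<rho> m y"
proof -
  have "Vector_Spaces.linear smul smul (\<rho> m)"
    using rep assms by (simp add: quad_representation_def)
  then interpret Vector_Spaces.linear smul smul "\<rho> m" .
  show "\<rho> m (x + y) = \<rho> m x + \<rho> m y" "\<rho> m (smul c x) = smul c (\<rho> m x)" "\<rho> m 0 = 0"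
    "\<rho> m (x - y) = \<rho> m x - \<rho> m y"
    by (simp_all add: add scale zero diff)
qed

lemma rep_tetrad:
  "\<rho> (d11_mat x1 y1) (\<rho> (d11_mat x2 y2) (\<rho> (d11_mat x3 y3) (\<rho> (d11_mat x4 y4) v))) +
    \<rho> (d11_mat x4 y4) (\<rho> (d11_mat x3 y3) (\<rho> (d11_mat x2 y2) (\<rho> (d11_mat x1 y1) v))) =
    \<rho> (d11_mat (x1 * x4 * (x2 * y3 + y2 * x3)) (2 * y1 * y4 * x2 * x3)) v"
  using rep by (simp add: quad_representation_def flip: tetrad_d11_mat)

lemma rep_scale: "m \<in> D11 \<Longrightarrow> \<rho> (mat_scale c m) v = smul c (\<rho> m v)"
  using rep by (simp add: quad_representation_def)

lemma rep_0: "\<rho> 0 v = 0"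
  using rep_scale[OF d11_mat_in_D11[of 0 0], of 0 v] by simp

lemma rep_d11_mat:
  "\<rho> (d11_mat x y) v = smul x (\<rho> (d11_mat 1 0) v) + smul y (\<rho> (d11_mat 0 1) v)"
proof -
  have "\<rho> (d11_mat x y) v = \<rho> (mat_scale x (d11_mat 1 0) + mat_scale y (d11_mat 0 1)) v"
    by (simp add: d11_mat_decompose[of x y])
  also have "\<dots> = smul x (\<rho> (d11_mat 1 0) v) + smul y (\<rho> (d11_mat 0 1) v)"
    using rep mat_vs.subspace_scale[OF subspace_D11] by (simp add: quad_representation_def)
  finally show ?thesis .
qed

lemma add_self_eq: "x + x = smul 2 x"
  by (metis one_add_one scale_left_distrib scale_one)

lemma d11_action_rep: "d11_action UNIV {0} (\<rho> (d11_mat 1 0)) (\<rho> (d11_mat 0 1))"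
proof -
  have 2: "\<rho> (d11_mat 0 2) v = smul 2 (\<rho> (d11_mat 0 1) v)" for v
    by (simp add: rep_d11_mat[of 0 2])
  show ?thesis
  proof
    fix v
    \<comment> \<open>The words \<open>aaaa\<close>, \<open>bbbb\<close> and \<open>baab\<close> are
      palindromes, so the two terms of their tetrads coincide and a factor 2 has to be
      cancelled.\<close>
    show "\<rho> (d11_mat 1 0) (\<rho> (d11_mat 1 0) (\<rho> (d11_mat 1 0) (\<rho> (d11_mat 1 0) v))) \<in> {0}"
      using rep_tetrad[of 1 0 1 0 1 0 1 0 v] by (simp add: rep_0 add_self_eq)
    show "\<rho> (d11_mat 0 1) (\<rho> (d11_mat 0 1) (\<rho> (d11_mat 0 1) (\<rho> (d11_mat 0 1) v))) \<in> {0}"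
      using rep_tetrad[of 0 1 0 1 0 1 0 1 v] by (simp add: rep_0 add_self_eq)
    show "\<rho> (d11_mat 0 1) (\<rho> (d11_mat 1 0) (\<rho> (d11_mat 1 0) (\<rho> (d11_mat 0 1) v)))
        - \<rho> (d11_mat 0 1) v \<in> {0}"
      using rep_tetrad[of 0 1 1 0 1 0 0 1 v] by (simp add: 2 add_self_eq)
  qed (use rep_tetrad[of 1 0 1 0 0 1 0 1] rep_tetrad[of 1 0 1 0 1 0 0 1]
      rep_tetrad[of 1 0 1 0 0 1 1 0] in \<open>simp_all add: rep_linear rep_0\<close>)
qed

lemma irreducible_imp_trivial_or_natural:
  assumes irr: "irreducible_representation D11 smul \<rho>"
  shows "isomorphic_representations D11 smul \<rho> ((*) :: rat \<Rightarrow> rat \<Rightarrow> rat) trivial_rep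
    \<or> isomorphic_representations D11 smul \<rho> ((*s) :: rat \<Rightarrow> rat^3 \<Rightarrow> rat^3) natural_rep"
proof -
  define A B where "A = \<rho> (d11_mat 1 0)" and "B = \<rho> (d11_mat 0 1)"
  interpret d11_action UNIV "{0}" A B
    unfolding A_def B_def by (rule d11_action_rep)
  have lin: "A (x + y) = A x + A y" "A (smul c x) = smul c (A x)" "A 0 = 0"
    "B (x + y) = B x + B y" "B (smul c x) = smul c (B x)" "B 0 = 0" for x y c
    by (simp_all add: A_def B_def rep_linear)
  have rho: "\<rho> (d11_mat x y) v = smul x (A v) + smul y (B v)" for x y v
    unfolding A_def B_def by (rule rep_d11_mat)
  have rels: "A (A (A v)) = 0" "B (B v) = 0" "B (A (B v)) = 0" "B (A (A (B v))) = B v"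
    "A v = A (A (B (A v))) + A (B (A (A v)))" for v
    using aaa bb bab baab[of v] aaba[of v] by auto
  have inv_subspace: "W = {0} \<or> W = UNIV"
    if "subspace W" "\<And>w. w \<in> W \<Longrightarrow> A w \<in> W" "\<And>w. w \<in> W \<Longrightarrow> B w \<in> W" for W
  proof -
    have "\<forall>a\<in>D11. \<forall>w\<in>W. \<rho> a w \<in> W"
      using that subspace_add[OF that(1)] subspace_scale[OF that(1)]
      by (auto simp: D11_eq rho)
    with irr that(1) show ?thesis
      by (simp add: irreducible_representation_def)
  qed
  obtain v0 :: 'v where v0: "v0 \<noteq> 0"
    using irr by (auto simp: irreducible_representation_def)
  show ?thesis
  proof (cases "\<forall>v. B (A (A v)) = 0")
    case True
    have B0: "B v = 0" for v
      using rels(4)[of v] True by simp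
    have A0: "A v = 0" for v
      using rels(5)[of v] by (simp add: B0 lin)
    \<comment> \<open>Both generators act as zero, so every line is invariant; by irreducibility the
      line through \<open>v0\<close> is the whole space.\<close>
    let ?W = "range (\<lambda>k. smul k v0)"
    have "subspace ?W"
    proof (rule subspaceI)
      show "0 \<in> ?W"
        by (metis rangeI scale_zero_left)
      show "x + y \<in> ?W" if "x \<in> ?W" "y \<in> ?W" for x y
        using that by (auto simp flip: scale_left_distrib)
      show "smul c x \<in> ?W" if "x \<in> ?W" for c x
        using that by auto
    qed
    then have "?W = {0} \<or> ?W = UNIV"
      by (rule inv_subspace) (auto simp: A0 B0 lin intro: range_eqI[of _ _ 0])
    moreover have "v0 \<in> ?W"
      by (metis rangeI scale_one)
    ultimately have "surj (\<lambda>k. smul k v0)"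
      using v0 by auto
    then have "bij (\<lambda>k. smul k v0)"
      using v0 by (auto simp: bij_def inj_def)
    moreover have "Vector_Spaces.linear (*) smul (\<lambda>k. smul k v0)"
      by (auto simp: Vector_Spaces.linear_iff vector_space_over_itself.vector_space_axioms
          vector_space_axioms scale_left_distrib)
    ultimately have "isomorphic_representations D11 smul \<rho> ((*) :: rat \<Rightarrow> rat \<Rightarrow> rat) trivial_rep"
      by (intro isomorphic_representations_flip[where f = "\<lambda>k. smul k v0"])
        (auto simp: trivial_rep_def D11_eq rho A0 B0)
    then show ?thesis ..
  next
    case False
    then obtain v where v: "B (A (A v)) \<noteq> 0"
      by blast
    define u where "u = B (A (A v))"
    have u: "B (A (A u)) = u" "B u = 0" "B (A u) = 0" "A (A (A u)) = 0" and "u \<noteq> 0"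
      using v by (simp_all add: u_def rels(1-4))
    \<comment> \<open>In the natural representation \<open>a\<close> sends the third standard vector
      to the first and the first to the second. The images of the standard basis are therefore
      forced once the third vector goes to \<open>u\<close>.\<close>
    define f :: "rat^3 \<Rightarrow> 'v"
      where "f x = smul (x $ 1) (A u) + smul (x $ 2) (A (A u)) + smul (x $ 3) u" for x
    have Af: "A (f x) = f (vector [x $ 3, x $ 1, 0])"
      and Bf: "B (f x) = f (vector [0, 0, x $ 2])" for x
      by (simp_all add: f_def lin u)
    have f: "Vector_Spaces.linear (*s) smul f"
      by (simp add: Vector_Spaces.linear_iff vec.vector_space_axioms vector_space_axioms f_def
          scale_left_distrib scale_right_distrib add_ac)
    then have f_lin: "f (x + y) = f x + f y" "f (c *s x) = smul c (f x)" for x y c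
      by (simp_all add: Vector_Spaces.linear_iff)
    have "f x = f y \<longleftrightarrow> x = y" for x y
    proof
      assume eq: "f x = f y"
      \<comment> \<open>These three operators extract the coordinates of \<open>x\<close> as
        multiples of the nonzero vector \<open>u\<close>, which gives injectivity.\<close>
      have f3: "B (A (A (f x))) = smul (x $ 3) u" "B (A (f x)) = smul (x $ 1) u"
        "B (f x) = smul (x $ 2) u" for x
        by (simp_all add: Af Bf) (simp_all add: f_def)
      show "x = y"
        using f3[of x] f3[of y] eq \<open>u \<noteq> 0\<close> by (simp add: vec_eq_iff forall_3)
    qed auto
    then have "inj f"
      by (simp add: inj_def)
    have "subspace (range f)"
    proof (rule subspaceI)
      show "0 \<in> range f"
        by (rule range_eqI[of _ _ 0]) (simp add: f_def)
      show "x + y \<in> range f" if "x \<in> range f" "y \<in> range f" for x y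
        using that by (auto simp flip: f_lin)
      show "smul c x \<in> range f" if "x \<in> range f" for c x
        using that by (auto simp flip: f_lin)
    qed
    then have "range f = {0} \<or> range f = UNIV"
      by (rule inv_subspace) (auto simp: Af Bf)
    moreover have "u \<in> range f"
      by (rule range_eqI[of _ _ "vector [0, 0, 1]"]) (simp add: f_def)
    ultimately have "surj f"
      using \<open>u \<noteq> 0\<close> by auto
    have nat: "f (natural_rep a x) = \<rho> a (f x)" if "a \<in> D11" for a x
    proof -
      obtain p q where a: "a = d11_mat p q"
        using \<open>a \<in> D11\<close> by (auto simp: D11_eq)
      have "\<rho> a (f x) = smul p (f (vector [x $ 3, x $ 1, 0])) + smul q (f (vector [0, 0, x $ 2]))"
        by (simp add: a rho Af Bf)
      also have "\<dots> = f (natural_rep a x)"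
        by (simp add: a natural_rep_def d11_mat_mult_vector f_def scale_right_distrib)
      finally show ?thesis ..
    qed
    have "bij f"
      using \<open>inj f\<close> \<open>surj f\<close> by (simp add: bij_def)
    have "isomorphic_representations D11 smul \<rho> ((*s) :: rat \<Rightarrow> rat^3 \<Rightarrow> rat^3) natural_rep"
      by (rule isomorphic_representations_flip[OF f \<open>bij f\<close>]) (simp add: nat)
    then show ?thesis ..
  qed
qed

end

section \<open>Noncommutative polynomials\<close>

abbreviation free_scale :: "rat \<Rightarrow> ('b list \<Rightarrow>\<^sub>0 rat) \<Rightarrow> ('b list \<Rightarrow>\<^sub>0 rat)"
  where "free_scale c \<equiv> Poly_Mapping.map ((*) c)"

lemma lookup_free_scale [simp]: "Poly_Mapping.lookup (free_scale c f) w = c * Poly_Mapping.lookup f w"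
  by (simp add: Poly_Mapping.map.rep_eq when_def)

lemma free_scale_mult [simp]: "free_scale c f * g = free_scale c (f * g)"
  by (simp add: mult_map_scale_conv_mult mult.assoc)

lemma poly_mapping_sum_single:
  "f = (\<Sum>w\<in>Poly_Mapping.keys f. Poly_Mapping.single w (Poly_Mapping.lookup f w))"
  by (rule poly_mapping_eqI) (auto simp: lookup_sum lookup_single when_def in_keys_iff)

lemma carrier_free_alg: "f \<in> carrier (free_alg B) \<longleftrightarrow> (\<forall>w\<in>Poly_Mapping.keys f. set w \<subseteq> B)"
  by (simp add: free_alg_def)

lemma free_alg_simps [simp]:
  "f \<otimes>\<^bsub>free_alg B\<^esub> g = f * g" "f \<oplus>\<^bsub>free_alg B\<^esub> g = f + g" "\<one>\<^bsub>free_alg B\<^esub> = 1" "\<zero>\<^bsub>free_alg B\<^esub> = 0"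
  "c \<odot>\<^bsub>free_alg B\<^esub> f = free_scale c f"
  by (simp_all add: free_alg_def)

text \<open>Every polynomial is a finite sum of scaled words, so additive statements need checking
  on words only.\<close>

lemma free_induct [consumes 1, case_names zero single add]:
  assumes f: "f \<in> carrier (free_alg B)"
    and zero: "P 0"
    and single: "\<And>w c. set w \<subseteq> B \<Longrightarrow> P (Poly_Mapping.single w c)"
    and add: "\<And>f g. P f \<Longrightarrow> P g \<Longrightarrow> P (f + g)"
  shows "P f"
proof -
  have "P (\<Sum>w\<in>A. Poly_Mapping.single w (Poly_Mapping.lookup f w))"
    if "finite A" "\<And>w. w \<in> A \<Longrightarrow> set w \<subseteq> B" for A
    using that by (induction A) (auto intro: zero single add)
  from this[of "Poly_Mapping.keys f"] f show ?thesis
    by (simp add: carrier_free_alg flip: poly_mapping_sum_single)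
qed

lemma free_induct_UNIV [case_names zero single add]:
  fixes f :: "'b list \<Rightarrow>\<^sub>0 rat"
  assumes "P 0" "\<And>w c. P (Poly_Mapping.single w c)" "\<And>f g. P f \<Longrightarrow> P g \<Longrightarrow> P (f + g)"
  shows "P f"
  using assms by (intro free_induct[of f UNIV P]) (auto simp: carrier_free_alg)

lemma free_scale_add: "free_scale c (f + g) = free_scale c f + free_scale c g"
  and free_scale_diff: "free_scale c (f - g) = free_scale c f - free_scale c g"
  and free_scale_sum: "free_scale c (sum F A) = (\<Sum>i\<in>A. free_scale c (F i))"
  and free_scale_add_left: "free_scale (c + d) f = free_scale c f + free_scale d f"
  and free_scale_diff_left: "free_scale (c - d) f = free_scale c f - free_scale d f"
  and free_scale_free_scale: "free_scale c (free_scale d f) = free_scale (c * d) f"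
  and free_scale_0 [simp]: "free_scale 0 f = 0"
  and free_scale_1 [simp]: "free_scale 1 f = f"
  by (rule poly_mapping_eqI, simp add: lookup_add lookup_minus lookup_sum algebra_simps sum_distrib_left)+

lemma free_scale_0_right [simp]: "free_scale c 0 = 0"
  by (rule poly_mapping_eqI) simp

text \<open>The product is not commutative, so the rule for the left factor does not transfer by
  symmetry; expanding both factors into words reduces it to coefficients.\<close>

lemma mult_free_scale [simp]: "f * free_scale c g = free_scale c (f * g)"
proof (induction f rule: free_induct_UNIV)
  case (single w d)
  show ?case
  proof (induction g rule: free_induct_UNIV)
    case (single v e)
    then show ?case by (simp add: mult_single mult.left_commute)
  qed (simp_all add: free_scale_add distrib_left)
qed (simp_all add: free_scale_add distrib_right)

lemma free_scale_in_carrier: "f \<in> carrier (free_alg B) \<Longrightarrow> free_scale c f \<in> carrier (free_alg B)"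
  by (auto simp: carrier_free_alg in_keys_iff)

lemma carrier_free_alg_closed:
  assumes "f \<in> carrier (free_alg B)" "g \<in> carrier (free_alg B)"
  shows "f + g \<in> carrier (free_alg B)" "f - g \<in> carrier (free_alg B)" "f * g \<in> carrier (free_alg B)"
proof -
  interpret ring "free_alg B"
    by (rule ring_free_alg)
  show "f + g \<in> carrier (free_alg B)" and "f * g \<in> carrier (free_alg B)"
    using a_closed[OF assms] m_closed[OF assms] by simp_all
  have "f - g = f + free_scale (- 1) g"
    by (rule poly_mapping_eqI) (simp add: lookup_add lookup_minus)
  then show "f - g \<in> carrier (free_alg B)"
    using a_closed[OF assms(1) free_scale_in_carrier[OF assms(2)]] by (simp only: free_alg_simps)
qed

section \<open>Evaluation in matrices and at zero\<close>

lemma mat_scale_mult: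
  "mat_scale c X ** Y = mat_scale c (X ** Y)" "X ** mat_scale c Y = mat_scale c (X ** Y)"
  by (simp_all add: mat_scale_def matrix_matrix_mult_def vec_eq_iff sum_distrib_left mult_ac)

lemma matrix_add_rdistrib: "(X + Y) ** Z = X ** Z + Y ** (Z :: 'a::semiring_1^'n^'m)"
  by (simp add: matrix_matrix_mult_def vec_eq_iff sum.distrib algebra_simps)

definition word_mat :: "(rat^'n^'n) list \<Rightarrow> rat^'n^'n"
  where "word_mat w = foldr (**) w (mat 1)"

lemma word_mat_simps [simp]: "word_mat [] = mat 1" "word_mat (e # w) = e ** word_mat w"
  by (simp_all add: word_mat_def)

lemma word_mat_append: "word_mat (v @ w) = word_mat v ** word_mat w"
  by (induction v) (simp_all add: matrix_mul_assoc)

text \<open>The letters are themselves matrices, so this is the homomorphism from the free algebra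
  that extends the inclusion of the letters: the natural representation on polynomials.\<close>

definition eval_mat :: "((rat^'n^'n) list \<Rightarrow>\<^sub>0 rat) \<Rightarrow> rat^'n^'n"
  where "eval_mat f = (\<Sum>w\<in>Poly_Mapping.keys f. mat_scale (Poly_Mapping.lookup f w) (word_mat w))"

text \<open>Summing over a larger set allows polynomials with different supports to be compared term
  by term.\<close>

lemma eval_mat_superset:
  assumes "finite A" "Poly_Mapping.keys f \<subseteq> A"
  shows "eval_mat f = (\<Sum>w\<in>A. mat_scale (Poly_Mapping.lookup f w) (word_mat w))"
  unfolding eval_mat_def using assms by (intro sum.mono_neutral_left) (auto simp: in_keys_iff)

lemma eval_mat_single [simp]: "eval_mat (Poly_Mapping.single w c) = mat_scale c (word_mat w)"
  by (subst eval_mat_superset[of "{w}"]) auto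

lemma eval_mat_0 [simp]: "eval_mat 0 = 0"
  by (simp add: eval_mat_def)

lemma eval_mat_add: "eval_mat (f + g) = eval_mat f + eval_mat g"
proof -
  let ?A = "Poly_Mapping.keys f \<union> Poly_Mapping.keys g"
  show ?thesis
    using Poly_Mapping.keys_add[of f g]
    by (simp add: eval_mat_superset[of ?A] lookup_add mat_vs.scale_left_distrib sum.distrib)
qed

lemma eval_mat_scale: "eval_mat (free_scale c f) = mat_scale c (eval_mat f)"
  by (subst eval_mat_superset[of "Poly_Mapping.keys f"])
    (auto simp: eval_mat_def mat_vs.scale_sum_right in_keys_iff)

lemma eval_mat_diff: "eval_mat (f - g) = eval_mat f - eval_mat g"
  using eval_mat_add[of "f - g" g] by simp

lemma eval_mat_sum: "eval_mat (sum F A) = (\<Sum>i\<in>A. eval_mat (F i))"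
  by (induction A rule: infinite_finite_induct) (simp_all add: eval_mat_add)

lemma eval_mat_1 [simp]: "eval_mat 1 = mat 1"
  by (simp add: zero_list_def flip: single_one)

lemma eval_mat_mult: "eval_mat (f * g) = eval_mat f ** eval_mat g"
proof (induction f rule: free_induct_UNIV)
  case (single w d)
  show ?case
  proof (induction g rule: free_induct_UNIV)
    case (single v e)
    then show ?case by (simp add: mult_single mat_scale_mult word_mat_append plus_list_def)
  qed (simp_all add: distrib_left eval_mat_add matrix_add_ldistrib)
qed (simp_all add: distrib_right eval_mat_add matrix_add_rdistrib)

text \<open>This is evaluation with every letter set to 0, that is, the trivial representation on
  polynomials.\<close>

definition const_coeff :: "('b list \<Rightarrow>\<^sub>0 rat) \<Rightarrow> rat"
  where "const_coeff f = Poly_Mapping.lookup f []"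

lemma const_coeff_simps [simp]:
  "const_coeff 0 = 0" "const_coeff 1 = 1" "const_coeff (f + g) = const_coeff f + const_coeff g"
  "const_coeff (f - g) = const_coeff f - const_coeff g"
  "const_coeff (free_scale c f) = c * const_coeff f"
  "const_coeff (sum F A) = (\<Sum>i\<in>A. const_coeff (F i))"
  "const_coeff (Poly_Mapping.single w c) = (c when w = [])"
  by (simp_all add: const_coeff_def lookup_add lookup_minus lookup_sum lookup_single lookup_one
      zero_list_def)

text \<open>A concatenation is empty only if both words are.\<close>

lemma const_coeff_mult [simp]: "const_coeff (f * g) = const_coeff f * const_coeff g"
proof (induction f rule: free_induct_UNIV)
  case (single w d)
  show ?case
  proof (induction g rule: free_induct_UNIV)
    case (single v e)
    then show ?case by (auto simp: mult_single plus_list_def when_def)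
  qed (simp_all add: distrib_left)
qed (simp_all add: distrib_right)

section \<open>Linear forms in a basis\<close>

lemma lookup_linear_form:
  "Poly_Mapping.lookup (linear_form B v) w =
    (if length w = 1 then mat_vs.representation B v (hd w) else 0)"
proof -
  have "Poly_Mapping.lookup (linear_form B v) w =
      (\<Sum>e | mat_vs.representation B v e \<noteq> 0. if [e] = w then mat_vs.representation B v e else 0)"
    by (simp add: linear_form_def lookup_sum lookup_single when_def)
  also have "\<dots> = (if length w = 1 then mat_vs.representation B v (hd w) else 0)"
  proof (cases "length w = 1")
    case True
    then obtain e where "w = [e]"
      by (auto simp: length_Suc_conv)
    then show ?thesis
      by (simp add: mat_vs.finite_representation)
  next
    case False
    then have "[e] \<noteq> w" for e
      by auto
    with False show ?thesis
      by simp
  qed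
  finally show ?thesis .
qed

lemma linear_form_in_carrier: "linear_form B v \<in> carrier (free_alg B)"
  unfolding carrier_free_alg
proof
  fix w
  assume w: "w \<in> Poly_Mapping.keys (linear_form B v)"
  then have "length w = 1" "mat_vs.representation B v (hd w) \<noteq> 0"
    by (auto simp: in_keys_iff lookup_linear_form split: if_splits)
  then show "set w \<subseteq> B"
    by (cases w) (auto dest: mat_vs.representation_ne_zero)
qed

lemma const_coeff_linear_form [simp]: "const_coeff (linear_form B v) = 0"
  by (simp add: const_coeff_def lookup_linear_form)

context
  fixes B :: "(rat^'n^'n) set"
  assumes B: "mat_vs.independent B"
begin

lemma linear_form_add:
  "u \<in> mat_vs.span B \<Longrightarrow> v \<in> mat_vs.span B \<Longrightarrow>
    linear_form B (u + v) = linear_form B u + linear_form B v"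
  using B by (intro poly_mapping_eqI)
    (simp add: lookup_linear_form lookup_add mat_vs.representation_add)

lemma linear_form_scale:
  "v \<in> mat_vs.span B \<Longrightarrow> linear_form B (mat_scale c v) = free_scale c (linear_form B v)"
  using B by (intro poly_mapping_eqI)
    (simp add: lookup_linear_form mat_vs.representation_scale)

lemma linear_form_basis:
  assumes "b \<in> B"
  shows "linear_form B b = monomial [b]"
proof (rule poly_mapping_eqI)
  fix w
  show "Poly_Mapping.lookup (linear_form B b) w = Poly_Mapping.lookup (monomial [b]) w"
    using B assms
    by (cases w) (auto simp: lookup_linear_form monomial_def mat_vs.representation_basis
        lookup_single when_def)
qed

lemma eval_mat_linear_form: "v \<in> mat_vs.span B \<Longrightarrow> eval_mat (linear_form B v) = v"
  using B by (simp add: linear_form_def eval_mat_sum mat_vs.sum_nonzero_representation_eq)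

end

section \<open>The envelope\<close>

lemma tetrad_add:
  "tetrad (p + p') q r s = tetrad p q r s + tetrad p' q r s"
  "tetrad p (q + q') r s = tetrad p q r s + tetrad p q' r s"
  "tetrad p q (r + r') s = tetrad p q r s + tetrad p q r' s"
  "tetrad p q r (s + s') = tetrad p q r s + tetrad p q r s'"
  by (simp_all add: tetrad_def matrix_add_ldistrib matrix_add_rdistrib)

lemma tetrad_scale:
  "tetrad (mat_scale c p) q r s = mat_scale c (tetrad p q r s)"
  "tetrad p (mat_scale c q) r s = mat_scale c (tetrad p q r s)"
  "tetrad p q (mat_scale c r) s = mat_scale c (tetrad p q r s)"
  "tetrad p q r (mat_scale c s) = mat_scale c (tetrad p q r s)"
  by (simp_all add: tetrad_def mat_scale_mult mat_vs.scale_right_distrib)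

locale d11_basis =
  fixes B :: "(rat^3^3) set"
  assumes mat_basis: "mat_basis D11 B"
begin

abbreviation "L \<equiv> linear_form B"
abbreviation "C \<equiv> carrier (free_alg B)"
definition "I = Idl\<^bsub>free_alg B\<^esub> (envelope_relations B)"

lemma independent: "mat_vs.independent B" and span: "mat_vs.span B = D11"
  using mat_basis by (simp_all add: mat_basis_def)

lemma B_subset: "b \<in> B \<Longrightarrow> b \<in> D11"
  using span mat_vs.span_base by blast

lemma D11_closed:
  "p \<in> D11 \<Longrightarrow> q \<in> D11 \<Longrightarrow> p + q \<in> D11" "p \<in> D11 \<Longrightarrow> mat_scale c p \<in> D11"
  using mat_vs.subspace_add[OF subspace_D11] mat_vs.subspace_scale[OF subspace_D11] by blast+

lemma L_add: "p \<in> D11 \<Longrightarrow> q \<in> D11 \<Longrightarrow> L (p + q) = L p + L q"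
  and L_scale: "p \<in> D11 \<Longrightarrow> L (mat_scale c p) = free_scale c (L p)"
  and eval_mat_L: "p \<in> D11 \<Longrightarrow> eval_mat (L p) = p"
  using linear_form_add[OF independent] linear_form_scale[OF independent]
    eval_mat_linear_form[OF independent] by (simp_all add: span)

lemma L_0: "L 0 = 0"
  using L_scale[of 0 0] mat_vs.subspace_0[OF subspace_D11] by simp

lemma one_C: "1 \<in> C"
  by (auto simp: carrier_free_alg zero_list_def)

lemma monomial_mult: "monomial v * monomial w = monomial (v @ w)"
  by (simp add: monomial_def mult_single plus_list_def)

text \<open>Replacing letters by linear forms gives an expression that makes sense on all of
  \<open>D11\<close> and is linear in each of its four arguments.\<close>

lemma envelope_relations_eq:
  "envelope_relations B = {L p * L q * L r * L s + L s * L r * L q * L p - L (tetrad p q r s)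
    | p q r s. p \<in> B \<and> q \<in> B \<and> r \<in> B \<and> s \<in> B}"
proof -
  have "L p * L q * L r * L s + L s * L r * L q * L p
      = monomial [p, q, r, s] + monomial [s, r, q, p]"
    if "p \<in> B" "q \<in> B" "r \<in> B" "s \<in> B" for p q r s
    using that by (simp add: linear_form_basis[OF independent] monomial_mult)
  then show ?thesis
    unfolding envelope_relations_def by (intro Collect_cong iff_exI) auto
qed

lemma envelope_relations_subset: "envelope_relations B \<subseteq> C"
  by (auto simp: envelope_relations_eq linear_form_in_carrier intro!: carrier_free_alg_closed free_scale_in_carrier)

lemma ideal_I: "ideal I (free_alg B)"
  unfolding I_def by (rule ring.genideal_ideal[OF ring_free_alg envelope_relations_subset])

lemma I_0: "0 \<in> I"
  and I_add: "x \<in> I \<Longrightarrow> y \<in> I \<Longrightarrow> x + y \<in> I"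
  and I_mult_left: "x \<in> I \<Longrightarrow> f \<in> C \<Longrightarrow> f * x \<in> I"
  and I_mult_right: "x \<in> I \<Longrightarrow> f \<in> C \<Longrightarrow> x * f \<in> I"
  using additive_subgroup.zero_closed[OF ideal.axioms(1)[OF ideal_I]]
    additive_subgroup.a_closed[OF ideal.axioms(1)[OF ideal_I]]
    ideal.I_l_closed[OF ideal_I] ideal.I_r_closed[OF ideal_I]
  by simp_all

lemma I_scale: "x \<in> I \<Longrightarrow> free_scale c x \<in> I"
  using I_mult_left[of x "free_scale c 1"] one_C by (simp add: carrier_free_alg_closed free_scale_in_carrier)

lemma I_uminus: "x \<in> I \<Longrightarrow> - x \<in> I"
proof -
  have "free_scale (- 1) x = - x"
    by (rule poly_mapping_eqI) simp
  then show "x \<in> I \<Longrightarrow> - x \<in> I"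
    using I_scale[of x "- 1"] by simp
qed

lemma I_diff: "x \<in> I \<Longrightarrow> y \<in> I \<Longrightarrow> x - y \<in> I"
  using I_add[OF _ I_uminus] by simp

lemma I_sum: "(\<And>i. i \<in> A \<Longrightarrow> F i \<in> I) \<Longrightarrow> sum F A \<in> I"
  by (induction A rule: infinite_finite_induct) (simp_all add: I_0 I_add)

text \<open>Induction over the span of \<open>B\<close>. Since \<open>F\<close> is assumed linear on
  \<open>D11\<close> only, the induction carries membership in \<open>D11\<close> along.\<close>

lemma linear_in_I:
  assumes add: "\<And>x y. x \<in> D11 \<Longrightarrow> y \<in> D11 \<Longrightarrow> F (x + y) = F x + F y"
    and scale: "\<And>c x. x \<in> D11 \<Longrightarrow> F (mat_scale c x) = free_scale c (F x)"
    and base: "\<And>b. b \<in> B \<Longrightarrow> F b \<in> I"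
    and p: "p \<in> D11"
  shows "F p \<in> I"
proof -
  have "p \<in> D11 \<and> F p \<in> I"
  proof (rule mat_vs.span_induct[where S = B and P = "\<lambda>p. p \<in> D11 \<and> F p \<in> I"])
    have "F 0 = 0"
      using scale[of 0 0] mat_vs.subspace_0[OF subspace_D11] by simp
    then show "mat_vs.subspace {p. p \<in> D11 \<and> F p \<in> I}"
      using mat_vs.subspace_0[OF subspace_D11]
      by (auto simp: mat_vs.subspace_def add scale D11_closed I_0 I_add I_scale)
  qed (use p base B_subset in \<open>auto simp: span\<close>)
  then show ?thesis ..
qed

text \<open>The defining relations concern basis elements only; multilinearity extends them.\<close>

lemma relation_in_I:
  assumes "p \<in> D11" "q \<in> D11" "r \<in> D11" "s \<in> D11"
  shows "L p * L q * L r * L s + L s * L r * L q * L p - L (tetrad p q r s) \<in> I"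
    (is "?R p q r s \<in> I")
proof -
  note simps = tetrad_in_D11 tetrad_add tetrad_scale D11_closed B_subset L_add L_scale
    distrib_left distrib_right free_scale_add free_scale_diff
  have 0: "?R p q r s \<in> I" if "p \<in> B" "q \<in> B" "r \<in> B" "s \<in> B" for p q r s
  proof -
    have "?R p q r s \<in> envelope_relations B"
      using that unfolding envelope_relations_eq by blast
    then show ?thesis
      unfolding I_def using ring.genideal_self[OF ring_free_alg envelope_relations_subset] by blast
  qed
  have 1: "?R p q r s \<in> I" if "p \<in> D11" "q \<in> B" "r \<in> B" "s \<in> B" for p q r s
    by (rule linear_in_I[where F = "\<lambda>p. ?R p q r s"]) (use that 0 in \<open>simp_all add: simps\<close>)
  have 2: "?R p q r s \<in> I" if "p \<in> D11" "q \<in> D11" "r \<in> B" "s \<in> B" for p q r s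
    by (rule linear_in_I[where F = "\<lambda>q. ?R p q r s"]) (use that 1 in \<open>simp_all add: simps\<close>)
  have 3: "?R p q r s \<in> I" if "p \<in> D11" "q \<in> D11" "r \<in> D11" "s \<in> B" for p q r s
    by (rule linear_in_I[where F = "\<lambda>r. ?R p q r s"]) (use that 2 in \<open>simp_all add: simps\<close>)
  show ?thesis
    by (rule linear_in_I[where F = "\<lambda>s. ?R p q r s"]) (use assms 3 in \<open>simp_all add: simps\<close>)
qed

text \<open>The basis \<open>B\<close> is arbitrary and may contain neither of the two standard
  matrices. Their linear forms \<alpha> and \<beta> serve as generators for every choice of
  \<open>B\<close>.\<close>

definition "\<alpha> = L (d11_mat 1 0)"
definition "\<beta> = L (d11_mat 0 1)"

lemma \<alpha>_C: "\<alpha> \<in> C" and \<beta>_C: "\<beta> \<in> C"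
  by (simp_all add: \<alpha>_def \<beta>_def linear_form_in_carrier)

lemma L_d11_mat: "L (d11_mat x y) = free_scale x \<alpha> + free_scale y \<beta>"
  by (subst d11_mat_decompose) (simp add: \<alpha>_def \<beta>_def L_add L_scale D11_closed)

lemma half_in_I:
  assumes "x + x \<in> I"
  shows "x \<in> I"
proof -
  have "free_scale (1/2) (x + x) = x"
    by (rule poly_mapping_eqI) (simp add: lookup_add)
  with I_scale[OF assms, of "1/2"] show ?thesis
    by simp
qed

text \<open>Multiplying a relation on the right by \<open>v\<close> turns it into a statement about
  left multiplications, the form required by \<open>d11_action\<close>.\<close>

lemma relation_action_in_I:
  assumes "p \<in> D11" "q \<in> D11" "r \<in> D11" "s \<in> D11" "v \<in> C"
  shows "L p * (L q * (L r * (L s * v))) + L s * (L r * (L q * (L p * v)))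
    - L (tetrad p q r s) * v \<in> I"
  using I_mult_right[OF relation_in_I[OF assms(1-4)] assms(5)]
  by (simp add: distrib_right left_diff_distrib mult.assoc)

lemma d11_action_envelope: "d11_action C I ((*) \<alpha>) ((*) \<beta>)"
proof
  fix v
  assume v: "v \<in> C"
  show "\<alpha> * (\<alpha> * (\<alpha> * (\<alpha> * v))) \<in> I"
    using relation_action_in_I[of "d11_mat 1 0" "d11_mat 1 0" "d11_mat 1 0" "d11_mat 1 0" v] v
    by - (rule half_in_I, simp add: tetrad_d11_mat L_0 flip: \<alpha>_def \<beta>_def)
  show "\<beta> * (\<beta> * (\<beta> * (\<beta> * v))) \<in> I"
    using relation_action_in_I[of "d11_mat 0 1" "d11_mat 0 1" "d11_mat 0 1" "d11_mat 0 1" v] v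
    by - (rule half_in_I, simp add: tetrad_d11_mat L_0 flip: \<alpha>_def \<beta>_def)
  show "\<alpha> * (\<alpha> * (\<beta> * (\<beta> * v))) + \<beta> * (\<beta> * (\<alpha> * (\<alpha> * v))) \<in> I"
    using relation_action_in_I[of "d11_mat 1 0" "d11_mat 1 0" "d11_mat 0 1" "d11_mat 0 1" v] v
    by (simp add: tetrad_d11_mat L_0 flip: \<alpha>_def \<beta>_def)
  show "\<alpha> * (\<alpha> * (\<alpha> * (\<beta> * v))) + \<beta> * (\<alpha> * (\<alpha> * (\<alpha> * v))) \<in> I"
    using relation_action_in_I[of "d11_mat 1 0" "d11_mat 1 0" "d11_mat 1 0" "d11_mat 0 1" v] v
    by (simp add: tetrad_d11_mat L_0 flip: \<alpha>_def \<beta>_def)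
  show "\<alpha> * (\<alpha> * (\<beta> * (\<alpha> * v))) + \<alpha> * (\<beta> * (\<alpha> * (\<alpha> * v))) - \<alpha> * v \<in> I"
    using relation_action_in_I[of "d11_mat 1 0" "d11_mat 1 0" "d11_mat 0 1" "d11_mat 1 0" v] v
    by (simp add: tetrad_d11_mat flip: \<alpha>_def \<beta>_def)
  \<comment> \<open>The tetrad of \<open>b, a, a, b\<close> is twice \<open>b\<close>; writing its
    linear form as a sum lets \<open>half_in_I\<close> halve the whole relation.\<close>
  have "L (d11_mat 0 2) = \<beta> + \<beta>"
    using free_scale_add_left[of 1 1 \<beta>] by (simp add: L_d11_mat)
  then show "\<beta> * (\<alpha> * (\<alpha> * (\<beta> * v))) - \<beta> * v \<in> I"
    using relation_action_in_I[of "d11_mat 0 1" "d11_mat 1 0" "d11_mat 1 0" "d11_mat 0 1" v] v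
    by - (rule half_in_I, simp add: tetrad_d11_mat algebra_simps flip: \<alpha>_def \<beta>_def)
qed (simp_all add: I_0 I_diff I_mult_left \<alpha>_C \<beta>_C carrier_free_alg_closed free_scale_in_carrier 
    right_diff_distrib)

section \<open>Matrix units and normal forms\<close>

text \<open>The third row of matrix units: with \<open>a\<close> = E13 + E21 and \<open>b\<close> =
  E32 one has \<open>ba\<close> = E31, \<open>b\<close> = E32 and \<open>baa\<close> = E33. The
  final branch is the index 3.\<close>

definition col :: "3 \<Rightarrow> _"
  where "col j = \<beta> * (if j = 1 then \<alpha> else if j = 2 then 1 else \<alpha> * \<alpha>)"

text \<open>
  The products \<open>\<alpha> (col j)\<close>, \<open>\<alpha> (\<alpha> (col j))\<close>, \<open>col j\<close> are the matrix units of column \<open>j\<close>, by rows.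
\<close>

definition unit_comb :: "rat^3^3 \<Rightarrow> _"
  where "unit_comb M = (\<Sum>j\<in>UNIV. free_scale (M $ 1 $ j) (\<alpha> * col j) +
    free_scale (M $ 2 $ j) (\<alpha> * (\<alpha> * col j)) + free_scale (M $ 3 $ j) (col j))"

lemma col_C: "col j \<in> C"
  by (simp add: col_def \<alpha>_C \<beta>_C one_C carrier_free_alg_closed free_scale_in_carrier)

text \<open>Each \<open>col j\<close> has the form \<open>bv\<close>, so these are
  \<open>aaa\<close>, \<open>bb\<close>, \<open>bab\<close> and \<open>baab\<close>, the first three
  applied to \<open>bv\<close> or to \<open>v\<close> as needed.\<close>

lemma col_in_I: "\<alpha> * (\<alpha> * (\<alpha> * col j)) \<in> I" "\<beta> * col j \<in> I" "\<beta> * (\<alpha> * col j) \<in> I"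
  "\<beta> * (\<alpha> * (\<alpha> * col j)) - col j \<in> I"
proof -
  interpret d11_action C I "(*) \<alpha>" "(*) \<beta>"
    by (rule d11_action_envelope)
  show "\<alpha> * (\<alpha> * (\<alpha> * col j)) \<in> I" "\<beta> * col j \<in> I" "\<beta> * (\<alpha> * col j) \<in> I"
    "\<beta> * (\<alpha> * (\<alpha> * col j)) - col j \<in> I"
    unfolding col_def using aaa bb bab baab
    by (simp_all add: \<alpha>_C \<beta>_C one_C carrier_free_alg_closed free_scale_in_carrier)
qed

lemma unit_comb_C: "unit_comb M \<in> C"
proof -
  have "sum F A \<in> C" if "\<And>j. F j \<in> C" for F and A :: "3 set"
    by (induction A rule: infinite_finite_induct)
      (simp_all add: that carrier_free_alg_closed, simp_all add: carrier_free_alg)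
  then show ?thesis
    unfolding unit_comb_def by this (simp add: \<alpha>_C col_C carrier_free_alg_closed free_scale_in_carrier)
qed

lemma unit_comb_diff: "unit_comb (M - N) = unit_comb M - unit_comb N"
  by (simp add: unit_comb_def free_scale_diff_left sum_subtractf sum.distrib algebra_simps)

lemma unit_comb_add: "unit_comb (M + N) = unit_comb M + unit_comb N"
  using unit_comb_diff[of "M + N" N] by simp

lemma unit_comb_scale: "unit_comb (mat_scale c M) = free_scale c (unit_comb M)"
  by (simp add: unit_comb_def mat_scale_def free_scale_free_scale free_scale_sum free_scale_add)

text \<open>Left multiplication by \<alpha> moves row 3 to row 1 and row 1 to row 2, exactly as the
  matrix does. Only row 2 leaves an error, a combination of the \<open>aaa\<close> words.\<close>

lemma \<alpha>_unit_comb: "\<alpha> * unit_comb M - unit_comb (d11_mat 1 0 ** M) \<in> I"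
proof -
  have "\<alpha> * unit_comb M - unit_comb (d11_mat 1 0 ** M) =
      (\<Sum>j\<in>UNIV. free_scale (M $ 2 $ j) (\<alpha> * (\<alpha> * (\<alpha> * col j))))"
    by (simp add: unit_comb_def sum_distrib_left distrib_left d11_mat_def matrix_matrix_mult_def sum_3)
  then show ?thesis
    by (simp add: I_sum I_scale col_in_I)
qed

lemma \<beta>_unit_comb: "\<beta> * unit_comb M - unit_comb (d11_mat 0 1 ** M) \<in> I"
proof -
  have "\<beta> * unit_comb M - unit_comb (d11_mat 0 1 ** M) =
      (\<Sum>j\<in>UNIV. free_scale (M $ 1 $ j) (\<beta> * (\<alpha> * col j)) +
      free_scale (M $ 2 $ j) (\<beta> * (\<alpha> * (\<alpha> * col j)) - col j) + free_scale (M $ 3 $ j) (\<beta> * col j))"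
    by (simp add: unit_comb_def sum_distrib_left distrib_left d11_mat_def matrix_matrix_mult_def sum_3
        free_scale_diff)
  then show ?thesis
    by (simp add: I_sum I_scale I_add col_in_I)
qed

text \<open>The matrix is E13 + E21, whose combination of units is \<open>abaa + aaba\<close>; its
  agreement with \<open>a\<close> modulo \<open>I\<close> is the relation
  \<open>aaba\<close>.\<close>

lemma \<alpha>_unit_comb1: "\<alpha> - unit_comb (d11_mat 1 0) \<in> I"
proof -
  interpret d11_action C I "(*) \<alpha>" "(*) \<beta>"
    by (rule d11_action_envelope)
  have "\<alpha> - unit_comb (d11_mat 1 0) =
      - (\<alpha> * (\<alpha> * (\<beta> * (\<alpha> * 1))) + \<alpha> * (\<beta> * (\<alpha> * (\<alpha> * 1))) - \<alpha> * 1)"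
    by (simp add: unit_comb_def col_def d11_mat_def sum_3)
  then show ?thesis
    by (simp only: I_uminus aaba[OF one_C])
qed

lemma \<beta>_unit_comb1: "\<beta> = unit_comb (d11_mat 0 1)"
  by (simp add: unit_comb_def col_def d11_mat_def sum_3)

text \<open>A preimage of the pair \<open>(c, M)\<close>. The unit 1 evaluates to
  \<open>c = 1\<close> and to the identity matrix, so the scalar part already contributes
  \<open>mat_scale c (mat 1)\<close>, which is subtracted from \<open>M\<close>.\<close>

definition normal_form :: "rat \<Rightarrow> rat^3^3 \<Rightarrow> _"
  where "normal_form c M = free_scale c 1 + unit_comb (M - mat_scale c (mat 1))"

lemma normal_form_add: "normal_form (c + d) (M + N) = normal_form c M + normal_form d N"
  by (simp add: normal_form_def free_scale_add_left mat_vs.scale_left_distrib unit_comb_add unit_comb_diff)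

lemma normal_form_0: "normal_form 0 M = unit_comb M"
  by (simp add: normal_form_def)

lemma normal_form_C: "normal_form c M \<in> C"
  by (simp add: normal_form_def one_C unit_comb_C carrier_free_alg_closed free_scale_in_carrier)

text \<open>A generator \<open>g\<close> that agrees with its own matrix combination annihilates
  \<open>1 - unit_comb (mat 1)\<close> modulo \<open>I\<close>, so the scalar \<open>c\<close>
  disappears from the product.\<close>

lemma mult_normal_form_aux:
  assumes "g \<in> C" "g - unit_comb A \<in> I" "\<And>M. g * unit_comb M - unit_comb (A ** M) \<in> I"
  shows "g * normal_form c M - unit_comb (A ** M) \<in> I"
proof -
  have "A ** M = A ** ((M - mat_scale c (mat 1)) + mat_scale c (mat 1))"
    by simp
  also have "\<dots> = A ** (M - mat_scale c (mat 1)) + mat_scale c A"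
    by (simp only: matrix_add_ldistrib mat_scale_mult matrix_mul_rid)
  finally have "A ** M = A ** (M - mat_scale c (mat 1)) + mat_scale c A" .
  then have "g * normal_form c M - unit_comb (A ** M) = free_scale c (g - unit_comb A) +
      (g * unit_comb (M - mat_scale c (mat 1)) - unit_comb (A ** (M - mat_scale c (mat 1))))"
    by (simp add: normal_form_def distrib_left unit_comb_add unit_comb_scale free_scale_diff algebra_simps)
  then show ?thesis
    using assms by (simp add: I_add I_scale)
qed

lemma L_normal_form:
  assumes "p \<in> D11"
  shows "L p * normal_form c M - unit_comb (p ** M) \<in> I"
proof -
  obtain x y where p: "p = d11_mat x y"
    using assms by (auto simp: D11_eq)
  have "p ** M = mat_scale x (d11_mat 1 0 ** M) + mat_scale y (d11_mat 0 1 ** M)"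
    unfolding p by (subst d11_mat_decompose) (simp add: matrix_add_rdistrib mat_scale_mult)
  then have "L p * normal_form c M - unit_comb (p ** M) =
      free_scale x (\<alpha> * normal_form c M - unit_comb (d11_mat 1 0 ** M)) +
      free_scale y (\<beta> * normal_form c M - unit_comb (d11_mat 0 1 ** M))"
    by (simp add: p L_d11_mat unit_comb_add unit_comb_scale distrib_right free_scale_diff)
  then show ?thesis
    using mult_normal_form_aux[OF \<alpha>_C \<alpha>_unit_comb1 \<alpha>_unit_comb]
      mult_normal_form_aux[OF \<beta>_C _ \<beta>_unit_comb] \<beta>_unit_comb1
    by (simp add: I_add I_scale I_0)
qed

text \<open>Words are built by adding letters on the left. Each new letter makes the constant
  coefficient zero and multiplies the matrix value, which is what \<open>L_normal_form\<close> does
  to normal forms.\<close>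

lemma free_alg_normal_form:
  assumes "f \<in> C"
  shows "f - normal_form (const_coeff f) (eval_mat f) \<in> I"
  using assms
proof (induction f rule: free_induct)
  case zero
  show ?case by (simp add: normal_form_0 unit_comb_def I_0)
next
  case (single u c)
  then show ?case
  proof (induction u)
    case Nil
    have "Poly_Mapping.single [] c = free_scale c (1 :: (rat^3^3) list \<Rightarrow>\<^sub>0 rat)"
      by (rule poly_mapping_eqI) (simp add: lookup_single lookup_one zero_list_def when_def)
    then show ?case by (simp add: normal_form_def unit_comb_def I_0 when_def eval_mat_scale)
  next
    case (Cons e u)
    let ?s = "Poly_Mapping.single u c"
    let ?normal_form = "normal_form (const_coeff ?s) (eval_mat ?s)"
    have e: "e \<in> B" "e \<in> D11" and IH: "?s - ?normal_form \<in> I"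
      using Cons B_subset by auto
    have eu: "Poly_Mapping.single (e # u) c = L e * ?s"
      using e by (simp add: linear_form_basis[OF independent] monomial_def mult_single plus_list_def)
    have "Poly_Mapping.single (e # u) c - normal_form (const_coeff (Poly_Mapping.single (e # u) c))
        (eval_mat (Poly_Mapping.single (e # u) c)) =
      L e * (?s - ?normal_form) + (L e * ?normal_form - unit_comb (e ** eval_mat ?s))"
      unfolding eu by (simp add: right_diff_distrib eval_mat_mult eval_mat_L[OF e(2)] normal_form_0)
    then show ?case
      using I_add[OF I_mult_left[OF IH linear_form_in_carrier] L_normal_form[OF e(2)]] by simp
  qed
next
  case (add f g)
  then show ?case
    using I_add[OF add] by (simp add: normal_form_add eval_mat_add algebra_simps)
qed

lemma eval_normal_form: "const_coeff (normal_form c M) = c" "eval_mat (normal_form c M) = M"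
proof -
  have "const_coeff (unit_comb M) = 0" for M
    by (simp add: unit_comb_def \<alpha>_def \<beta>_def col_def)
  then show "const_coeff (normal_form c M) = c"
    by (simp add: normal_form_def)
  have ev: "eval_mat \<alpha> = d11_mat 1 0" "eval_mat \<beta> = d11_mat 0 1"
    by (simp_all add: \<alpha>_def \<beta>_def eval_mat_L)
  have "eval_mat (unit_comb M) = M" for M
    by (simp add: unit_comb_def col_def eval_mat_sum eval_mat_add eval_mat_scale eval_mat_mult ev sum_3)
      (simp add: d11_mat_def vec_eq_iff forall_3 mat_scale_def matrix_matrix_mult_def sum_3 mat_def)
  then show "eval_mat (normal_form c M) = M"
    by (simp add: normal_form_def eval_mat_add eval_mat_scale)
qed

end

section \<open>From normal forms to the algebra isomorphism\<close>

lemma direct_sum_simps: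
  "carrier (alg_direct_sum R S) = carrier R \<times> carrier S"
  "mult (alg_direct_sum R S) = mult (RDirProd R S)"
  "one (alg_direct_sum R S) = one (RDirProd R S)"
  "zero (alg_direct_sum R S) = zero (RDirProd R S)"
  "add (alg_direct_sum R S) = add (RDirProd R S)"
  "c \<odot>\<^bsub>alg_direct_sum R S\<^esub> z = (c \<odot>\<^bsub>R\<^esub> fst z, c \<odot>\<^bsub>S\<^esub> snd z)"
  by (simp_all add: alg_direct_sum_def ring.defs module.defs RDirProd_carrier case_prod_beta)

lemma quotient_simps:
  "carrier (alg_quotient R J) = carrier (R Quot J)"
  "mult (alg_quotient R J) = mult (R Quot J)"
  "one (alg_quotient R J) = one (R Quot J)"
  "zero (alg_quotient R J) = zero (R Quot J)"
  "add (alg_quotient R J) = add (R Quot J)"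
  "c \<odot>\<^bsub>alg_quotient R J\<^esub> X = J <+>\<^bsub>R\<^esub> ((\<lambda>x. c \<odot>\<^bsub>R\<^esub> x) ` X)"
  by (simp_all add: alg_quotient_def ring.defs module.defs)

lemma RDirProd_simps:
  "(x, y) \<otimes>\<^bsub>RDirProd R S\<^esub> (x', y') = (x \<otimes>\<^bsub>R\<^esub> x', y \<otimes>\<^bsub>S\<^esub> y')"
  "(x, y) \<oplus>\<^bsub>RDirProd R S\<^esub> (x', y') = (x \<oplus>\<^bsub>R\<^esub> x', y \<oplus>\<^bsub>S\<^esub> y')"
  "\<one>\<^bsub>RDirProd R S\<^esub> = (\<one>\<^bsub>R\<^esub>, \<one>\<^bsub>S\<^esub>)" "\<zero>\<^bsub>RDirProd R S\<^esub> = (\<zero>\<^bsub>R\<^esub>, \<zero>\<^bsub>S\<^esub>)"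
  by (simp_all add: RDirProd_def DirProd_def monoid.defs)

lemma ring_rat_alg: "ring rat_alg"
  by (rule ringI; (rule abelian_groupI | rule monoidI)?)
    (auto simp: rat_alg_def algebra_simps intro: exI[of _ "- _"])

lemma ring_mat_alg: "ring (mat_alg :: (rat, rat^'n^'n) module)"
proof (rule ringI)
  show "abelian_group (mat_alg :: (rat, rat^'n^'n) module)"
    by (rule abelian_groupI) (auto simp: mat_alg_def add_ac intro: exI[of _ "- _"])
  show "Group.monoid (mat_alg :: (rat, rat^'n^'n) module)"
    by (rule monoidI) (auto simp: mat_alg_def matrix_mul_assoc)
qed (auto simp: mat_alg_def matrix_add_ldistrib matrix_add_rdistrib)

context d11_basis
begin

abbreviation "T \<equiv> RDirProd rat_alg (mat_alg :: (rat, rat^3^3) module)"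

definition "eval_pair f = (const_coeff f, eval_mat f)" for f :: "(rat^3^3) list \<Rightarrow>\<^sub>0 rat"

lemma ring_hom_eval_pair: "ring_hom_ring (free_alg B) T eval_pair"
  by (rule ring_hom_ringI[OF ring_free_alg RDirProd_ring[OF ring_rat_alg ring_mat_alg]])
    (simp_all add: eval_pair_def RDirProd_carrier RDirProd_simps eval_mat_add eval_mat_mult,
      simp_all add: rat_alg_def mat_alg_def)

lemma eval_pair_surj: "eval_pair ` C = carrier T"
proof -
  have "x \<in> eval_pair ` C" for x
    by (rule image_eqI[of _ _ "normal_form (fst x) (snd x)"]) (simp_all add: eval_pair_def eval_normal_form normal_form_C)
  then show ?thesis
    by (auto simp: RDirProd_carrier rat_alg_def mat_alg_def)
qed

text \<open>If both evaluations of \<open>f\<close> vanish, its normal form is zero, so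
  \<open>f\<close> lies in \<open>I\<close>. Conversely the kernel is an ideal containing the
  relations, hence contains the ideal they generate.\<close>

lemma kernel_eval_pair: "a_kernel (free_alg B) T eval_pair = I"
proof
  interpret ring_hom_ring "free_alg B" T eval_pair
    by (rule ring_hom_eval_pair)
  have zero: "\<zero>\<^bsub>T\<^esub> = (0, 0)"
    by (simp add: RDirProd_simps rat_alg_def mat_alg_def)
  show "a_kernel (free_alg B) T eval_pair \<subseteq> I"
  proof
    fix f
    assume "f \<in> a_kernel (free_alg B) T eval_pair"
    then have "f \<in> C" "const_coeff f = 0" "eval_mat f = 0"
      by (auto simp: a_kernel_def' zero eval_pair_def)
    then show "f \<in> I"
      using free_alg_normal_form[of f] by (simp add: normal_form_0 unit_comb_def)
  qed
  have "envelope_relations B \<subseteq> a_kernel (free_alg B) T eval_pair"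
  proof
    fix f
    assume f: "f \<in> envelope_relations B"
    then have "f \<in> C"
      using envelope_relations_subset by blast
    moreover have "eval_pair f = (0, 0)"
      using f by (auto simp: envelope_relations_eq eval_pair_def eval_mat_add eval_mat_diff
          eval_mat_mult eval_mat_L B_subset tetrad_in_D11) (simp_all add: tetrad_def)
    ultimately show "f \<in> a_kernel (free_alg B) T eval_pair"
      unfolding a_kernel_def' zero by blast
  qed
  then show "I \<subseteq> a_kernel (free_alg B) T eval_pair"
    unfolding I_def by (rule ring.genideal_minimal[OF ring_free_alg kernel_is_ideal])
qed

theorem envelope_isomorphic:
  "alg_isomorphic (universal_envelope B)
    (alg_direct_sum rat_alg (mat_alg :: (rat, rat^3^3) module))"
proof -
  interpret ring_hom_ring "free_alg B" T eval_pair
    by (rule ring_hom_eval_pair)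
  let ?h = "\<lambda>X. the_elem (eval_pair ` X)"
  \<comment> \<open>The first isomorphism theorem gives a ring isomorphism; compatibility with
    scalars is checked separately on coset representatives.\<close>
  have "?h \<in> ring_iso (free_alg B Quot I) T"
    using FactRing_iso_set[OF eval_pair_surj] by (simp add: kernel_eval_pair)
  then have iso: "?h \<in> ring_iso (universal_envelope B) (alg_direct_sum rat_alg mat_alg)"
    by (simp add: ring_iso_def ring_hom_def universal_envelope_def direct_sum_simps quotient_simps
        RDirProd_carrier I_def)
  have "?h (c \<odot>\<^bsub>universal_envelope B\<^esub> X) = c \<odot>\<^bsub>alg_direct_sum rat_alg mat_alg\<^esub> ?h X"
    if X: "X \<in> carrier (universal_envelope B)" for c X
  proof -
    obtain x where x: "x \<in> C" "X = I +>\<^bsub>free_alg B\<^esub> x"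
      using X by (auto simp: universal_envelope_def quotient_simps FactRing_def A_RCOSETS_def' I_def)
    have "c \<odot>\<^bsub>universal_envelope B\<^esub> X = I <+>\<^bsub>free_alg B\<^esub> free_scale c ` X"
      by (simp add: universal_envelope_def quotient_simps I_def)
    also have "\<dots> = I +>\<^bsub>free_alg B\<^esub> free_scale c x"
    proof (intro equalityI subsetI)
      fix z
      assume "z \<in> I <+>\<^bsub>free_alg B\<^esub> free_scale c ` X"
      then obtain i j where ij: "i \<in> I" "j \<in> I" "z = i + free_scale c (j + x)"
        unfolding x(2) a_r_coset_def' set_add_def' by auto
      then have "i + free_scale c j \<in> I" "z = (i + free_scale c j) + free_scale c x"
        by (simp_all add: I_add I_scale free_scale_add)
      then show "z \<in> I +>\<^bsub>free_alg B\<^esub> free_scale c x"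
        unfolding a_r_coset_def' by auto
    next
      fix z
      assume "z \<in> I +>\<^bsub>free_alg B\<^esub> free_scale c x"
      then obtain i where i: "i \<in> I" "z = i + free_scale c x"
        unfolding a_r_coset_def' by auto
      \<comment> \<open>Taking 0 from \<open>I\<close> exhibits the representative \<open>x\<close>
        in its own coset, so \<open>i + c x\<close> is in the sum of \<open>I\<close> and the scaled
        coset.\<close>
      have "x \<in> X"
        using I_0 unfolding x(2) a_r_coset_def' by force
      with i show "z \<in> I <+>\<^bsub>free_alg B\<^esub> free_scale c ` X"
        unfolding set_add_def' by auto
    qed
    finally show ?thesis
      using x the_elem_simp[of "free_scale c x"] the_elem_simp[of x]
      by (simp add: kernel_eval_pair free_scale_in_carrier direct_sum_simps eval_pair_def eval_mat_scale)
        (simp add: rat_alg_def mat_alg_def)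
  qed
  then show ?thesis
    unfolding alg_isomorphic_def by (intro bexI[OF _ iso] allI ballI)
qed

end

theorem proposition5p1:
  fixes smul :: "rat \<Rightarrow> 'v \<Rightarrow> 'v::ab_group_add"
  shows "(\<forall>B. mat_basis D11 B \<longrightarrow>
            alg_isomorphic (universal_envelope B)
              (alg_direct_sum rat_alg (mat_alg :: (rat, rat^3^3) module)))
    \<and> irreducible_representation D11 ((*) :: rat \<Rightarrow> rat \<Rightarrow> rat) trivial_rep
    \<and> irreducible_representation D11 ((*s) :: rat \<Rightarrow> rat^3 \<Rightarrow> rat^3) natural_rep
    \<and> \<not> isomorphic_representations D11 ((*) :: rat \<Rightarrow> rat \<Rightarrow> rat) trivial_rep
          ((*s) :: rat \<Rightarrow> rat^3 \<Rightarrow> rat^3) natural_rep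
    \<and> (\<forall>\<rho> :: rat^3^3 \<Rightarrow> 'v \<Rightarrow> 'v.
          finite_dim smul \<and> irreducible_representation D11 smul \<rho> \<longrightarrow>
            isomorphic_representations D11 smul \<rho>
              ((*) :: rat \<Rightarrow> rat \<Rightarrow> rat) trivial_rep
          \<or> isomorphic_representations D11 smul \<rho>
              ((*s) :: rat \<Rightarrow> rat^3 \<Rightarrow> rat^3) natural_rep)"
proof (intro conjI allI impI)
  show "alg_isomorphic (universal_envelope B)
      (alg_direct_sum rat_alg (mat_alg :: (rat, rat^3^3) module))" if "mat_basis D11 B" for B
    using that by (intro d11_basis.envelope_isomorphic d11_basis.intro)
next
  fix \<rho> :: "rat^3^3 \<Rightarrow> 'v \<Rightarrow> 'v"
  assume *: "finite_dim smul \<and> irreducible_representation D11 smul \<rho>"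
  then have "quad_representation D11 smul \<rho>"
    by (simp add: irreducible_representation_def)
  with * show "isomorphic_representations D11 smul \<rho> ((*) :: rat \<Rightarrow> rat \<Rightarrow> rat) trivial_rep
      \<or> isomorphic_representations D11 smul \<rho> ((*s) :: rat \<Rightarrow> rat^3 \<Rightarrow> rat^3) natural_rep"
    by (intro irreducible_imp_trivial_or_natural) auto
qed (fact irreducible_trivial_rep irreducible_natural_rep not_isomorphic_trivial_natural)+

end
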